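(* Let $\mathcal{P}=(P,\leq)$ be a finite EL-shellable poset (in particular, $\mathcal{P}$ is bounded). For every integer $m>1$ we have $\mu_{\mathcal{P}^{[m]}}(\hat{\mathbf{0}},\hat{\mathbf{1}})=0$, where $\hat{\mathbf{0}}=(\hat 0,\ldots,\hat 0)$ and $\hat{\mathbf{1}}=(\hat 1,\ldots,\hat 1)$ are the least and the greatest element of the poset of $m$-multichains $\mathcal{P}^{[m]}$.
   Context: For a finite poset $\mathcal{P}=(P,\leq)$ and an integer $m>0$, let $P^{[m]}=\{(x_1,\ldots,x_m)\in P^m\mid x_1\leq x_2\leq\cdots\leq x_m\}$, and let $\mathcal{P}^{[m]}=(P^{[m]},\leq)$ with the componentwise order. A poset is bounded if it has a unique minimal element $\hat 0$ and a unique maximal element $\hat 1$. The Möbius function of a finite poset $\mathcal{Q}$ is defined by $\mu_{\mathcal{Q}}(x,x)=1$, $\mu_{\mathcal{Q}}(x,y)=-\sum_{x\leq z<y}\mu_{\mathcal{Q}}(x,z)$ if $x<y$, and $\mu_{\mathcal{Q}}(x,y)=0$ otherwise. Write $x\lessdot y$ if $x<y$ and there is no $z$ with $x<z<y$. An edge-labeling of a bounded poset $\mathcal{P}$ is a map $\lambda:\{(x,y)\mid x\lessdot y\}\to\Lambda$, where $(\Lambda,\leq_\Lambda)$ is an arbitrary poset. A maximal chain $x_1\lessdot\cdots\lessdot x_s$ of an interval $[x,y]=\{z\in P\mid x\leq z\leq y\}$ has label sequence $(\lambda(x_1,x_2),\ldots,\lambda(x_{s-1},x_s))$; it is rising if this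 sequence is strictly increasing. Tuples over $\Lambda$ are compared lexicographically: $(k_1,\ldots,k_s)\leq_{\mathrm{lex}}(l_1,\ldots,l_t)$ if and only if either $s\leq t$ and $k_i=l_i$ for all $i\leq s$, or $k_i<_\Lambda l_i$ for the least $i$ with $k_i\neq l_i$. The map $\lambda$ is an EL-labeling if for every interval $[x,y]$ there is a unique rising maximal chain in $[x,y]$, and its label sequence is $\leq_{\mathrm{lex}}$ the label sequence of every other maximal chain of $[x,y]$. A bounded poset is EL-shellable if it admits an EL-labeling.
   Formalization: The poset is additionally assumed to satisfy 0̂ ≠ 1̂; for the one-element poset, which is bounded and vacuously EL-shellable, the Möbius number is 1 rather than 0. *)

theory Defs
  imports Main
begin

definition poset :: "'a set \<Rightarrow> ('a \<Rightarrow> 'a \<Rightarrow> bool) \<Rightarrow> bool" where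
  "poset P le \<longleftrightarrow> reflp_on P le \<and> antisymp_on P le \<and> transp_on P le"

definition finite_poset :: "'a set \<Rightarrow> ('a \<Rightarrow> 'a \<Rightarrow> bool) \<Rightarrow> bool" where
  "finite_poset P le \<longleftrightarrow> finite P \<and> poset P le"

definition strict :: "('a \<Rightarrow> 'a \<Rightarrow> bool) \<Rightarrow> 'a \<Rightarrow> 'a \<Rightarrow> bool" where
  "strict le x y \<longleftrightarrow> le x y \<and> x \<noteq> y"


subsection \<open>Bounded posets\<close>

definition minimal_in :: "'a set \<Rightarrow> ('a \<Rightarrow> 'a \<Rightarrow> bool) \<Rightarrow> 'a \<Rightarrow> bool" where
  "minimal_in P le x \<longleftrightarrow> x \<in> P \<and> \<not> (\<exists>y\<in>P. strict le y x)"

definition maximal_in :: "'a set \<Rightarrow> ('a \<Rightarrow> 'a \<Rightarrow> bool) \<Rightarrow> 'a \<Rightarrow> bool" where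
  "maximal_in P le x \<longleftrightarrow> x \<in> P \<and> \<not> (\<exists>y\<in>P. strict le x y)"

definition bounded_poset :: "'a set \<Rightarrow> ('a \<Rightarrow> 'a \<Rightarrow> bool) \<Rightarrow> bool" where
  "bounded_poset P le \<longleftrightarrow>
     poset P le \<and> (\<exists>!x. minimal_in P le x) \<and> (\<exists>!x. maximal_in P le x)"

text \<open>
  These two are meaningful for bounded posets only. In a finite bounded poset they are the least
  and the greatest element, see \<open>bot_elem_least\<close> and \<open>top_elem_greatest\<close> below.
\<close>

definition bot_elem :: "'a set \<Rightarrow> ('a \<Rightarrow> 'a \<Rightarrow> bool) \<Rightarrow> 'a" where
  "bot_elem P le = (THE x. minimal_in P le x)"

definition top_elem :: "'a set \<Rightarrow> ('a \<Rightarrow> 'a \<Rightarrow> bool) \<Rightarrow> 'a" where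
  "top_elem P le = (THE x. maximal_in P le x)"


subsection \<open>The Moebius function\<close>

text \<open>
  The value is left unspecified unless \<open>(P, le)\<close> is a finite poset containing both arguments.
\<close>

function mobius :: "'a set \<Rightarrow> ('a \<Rightarrow> 'a \<Rightarrow> bool) \<Rightarrow> 'a \<Rightarrow> 'a \<Rightarrow> int" where
  "mobius P le x y =
     (if finite_poset P le \<and> x \<in> P \<and> y \<in> P then
        if x = y then 1
        else if le x y then - (\<Sum>z \<in> {z \<in> P. le x z \<and> strict le z y}. mobius P le x z)
        else 0
      else undefined)"
  by pat_completeness auto
termination
proof (relation "Wellfounded.measure (\<lambda>(P, le, x, y). card {z \<in> P. le z y})", goal_cases)
  case 1
  show ?case by simp
next
  case (2 P le x y z)
  then have *: "finite P" "reflp_on P le" "antisymp_on P le" "transp_on P le"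
    "y \<in> P" "z \<in> P" "le z y" "z \<noteq> y"
    by (auto simp: finite_poset_def poset_def strict_def)
  have "{w \<in> P. le w z} \<subseteq> {w \<in> P. le w y}"
    using * by (auto dest: transp_onD)
  moreover have "y \<in> {w \<in> P. le w y}" "y \<notin> {w \<in> P. le w z}"
    using * by (auto dest: reflp_onD antisymp_onD)
  ultimately have "{w \<in> P. le w z} \<subset> {w \<in> P. le w y}" by blast
  then show ?case using * by (simp add: psubset_card_mono)
qed

declare mobius.simps [simp del]

lemma mobius_refl: "finite_poset P le \<Longrightarrow> x \<in> P \<Longrightarrow> mobius P le x x = 1"
  by (simp add: mobius.simps)

lemma mobius_less:
  assumes "finite_poset P le" "x \<in> P" "y \<in> P" "strict le x y"
  shows "mobius P le x y = - (\<Sum>z \<in> {z \<in> P. le x z \<and> strict le z y}. mobius P le x z)"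
  using assms by (subst mobius.simps) (simp add: strict_def)

lemma mobius_not_le:
  assumes "finite_poset P le" "x \<in> P" "y \<in> P" "\<not> le x y"
  shows "mobius P le x y = 0"
  using assms by (subst mobius.simps) (auto simp: finite_poset_def poset_def dest: reflp_onD)


subsection \<open>EL-shellability\<close>

definition covers :: "'a set \<Rightarrow> ('a \<Rightarrow> 'a \<Rightarrow> bool) \<Rightarrow> 'a \<Rightarrow> 'a \<Rightarrow> bool" where
  "covers P le x y \<longleftrightarrow>
     x \<in> P \<and> y \<in> P \<and> strict le x y \<and> \<not> (\<exists>z\<in>P. strict le x z \<and> strict le z y)"

text \<open>
  Maximal chains of \<open>[x, y]\<close>, listed increasingly: saturated chains from \<open>x\<close> to \<open>y\<close>.
\<close>

definition maximal_chain :: "'a set \<Rightarrow> ('a \<Rightarrow> 'a \<Rightarrow> bool) \<Rightarrow> 'a \<Rightarrow> 'a \<Rightarrow> 'a list \<Rightarrow> bool" where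
  "maximal_chain P le x y c \<longleftrightarrow>
     c \<noteq> [] \<and> hd c = x \<and> last c = y \<and> set c \<subseteq> {z \<in> P. le x z \<and> le z y} \<and>
     successively (covers P le) c"

definition label_seq :: "('a \<times> 'a \<Rightarrow> 'l) \<Rightarrow> 'a list \<Rightarrow> 'l list" where
  "label_seq f c = map f (zip c (tl c))"

definition rising :: "('l \<Rightarrow> 'l \<Rightarrow> bool) \<Rightarrow> 'l list \<Rightarrow> bool" where
  "rising leL ks \<longleftrightarrow> successively (strict leL) ks"

definition lex_le :: "('l \<Rightarrow> 'l \<Rightarrow> bool) \<Rightarrow> 'l list \<Rightarrow> 'l list \<Rightarrow> bool" where
  "lex_le leL ks ls \<longleftrightarrow>
     length ks \<le> length ls \<and> (\<forall>i < length ks. ks ! i = ls ! i) \<or>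
     (\<exists>i < min (length ks) (length ls). (\<forall>j < i. ks ! j = ls ! j) \<and> strict leL (ks ! i) (ls ! i))"

text \<open>Only the values of \<open>f\<close> on cover relations of \<open>(P, le)\<close> are relevant.\<close>

definition edge_labeling ::
    "'a set \<Rightarrow> ('a \<Rightarrow> 'a \<Rightarrow> bool) \<Rightarrow> 'l set \<Rightarrow> ('l \<Rightarrow> 'l \<Rightarrow> bool) \<Rightarrow> ('a \<times> 'a \<Rightarrow> 'l) \<Rightarrow> bool" where
  "edge_labeling P le L leL f \<longleftrightarrow>
     poset L leL \<and> (\<forall>x y. covers P le x y \<longrightarrow> f (x, y) \<in> L)"

definition EL_labeling ::
    "'a set \<Rightarrow> ('a \<Rightarrow> 'a \<Rightarrow> bool) \<Rightarrow> 'l set \<Rightarrow> ('l \<Rightarrow> 'l \<Rightarrow> bool) \<Rightarrow> ('a \<times> 'a \<Rightarrow> 'l) \<Rightarrow> bool" where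
  "EL_labeling P le L leL f \<longleftrightarrow>
     edge_labeling P le L leL f \<and>
     (\<forall>x\<in>P. \<forall>y\<in>P. le x y \<longrightarrow>
        (\<exists>c. maximal_chain P le x y c \<and> rising leL (label_seq f c) \<and>
          (\<forall>d. maximal_chain P le x y d \<and> rising leL (label_seq f d) \<longrightarrow> d = c) \<and>
          (\<forall>d. maximal_chain P le x y d \<and> d \<noteq> c \<longrightarrow>
             lex_le leL (label_seq f c) (label_seq f d))))"

text \<open>
  HOL cannot quantify over all label posets of all types inside a formula, so the type of the
  labels is a parameter; it is meant to be left as a type variable.
\<close>

definition EL_shellable :: "'l itself \<Rightarrow> 'a set \<Rightarrow> ('a \<Rightarrow> 'a \<Rightarrow> bool) \<Rightarrow> bool" where
  "EL_shellable T P le \<longleftrightarrow>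
     bounded_poset P le \<and>
     (\<exists>(L :: 'l set) (leL :: 'l \<Rightarrow> 'l \<Rightarrow> bool) (f :: 'a \<times> 'a \<Rightarrow> 'l). EL_labeling P le L leL f)"


subsection \<open>Multichains\<close>

definition multichains :: "'a set \<Rightarrow> ('a \<Rightarrow> 'a \<Rightarrow> bool) \<Rightarrow> nat \<Rightarrow> 'a list set" where
  "multichains P le m = {xs. length xs = m \<and> set xs \<subseteq> P \<and> successively le xs}"

abbreviation componentwise :: "('a \<Rightarrow> 'a \<Rightarrow> bool) \<Rightarrow> 'a list \<Rightarrow> 'a list \<Rightarrow> bool" where
  "componentwise le \<equiv> list_all2 le"


subsection \<open>Sanity checks\<close>

lemma finite_poset_multichains:
  assumes "finite_poset P le"
  shows "finite_poset (multichains P le m) (componentwise le)"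
proof -
  have P: "finite P" "reflp_on P le" "antisymp_on P le" "transp_on P le"
    using assms by (auto simp: finite_poset_def poset_def)
  have "finite (multichains P le m)"
    by (rule finite_subset[OF _ finite_lists_length_eq[OF P(1), of m]])
       (auto simp: multichains_def)
  moreover have "reflp_on (multichains P le m) (list_all2 le)"
    using P(2) by (auto simp: reflp_on_def multichains_def list_all2_conv_all_nth subset_iff)
  moreover have "antisymp_on (multichains P le m) (list_all2 le)"
  proof (rule antisymp_onI)
    fix xs ys assume "xs \<in> multichains P le m" "ys \<in> multichains P le m"
      "list_all2 le xs ys" "list_all2 le ys xs"
    then show "xs = ys"
      using P(3) by (auto intro!: nth_equalityI antisymp_onD[OF P(3)]
          simp: multichains_def list_all2_conv_all_nth subset_iff)
  qed
  moreover have "transp_on (multichains P le m) (list_all2 le)"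
  proof (rule transp_onI)
    fix xs ys zs assume A: "xs \<in> multichains P le m" "ys \<in> multichains P le m"
      "zs \<in> multichains P le m" "list_all2 le xs ys" "list_all2 le ys zs"
    show "list_all2 le xs zs"
      unfolding list_all2_conv_all_nth
    proof (intro conjI allI impI)
      show "length xs = length zs" using A by (simp add: multichains_def)
      fix i assume "i < length xs"
      then have "xs ! i \<in> P" "ys ! i \<in> P" "zs ! i \<in> P" "le (xs ! i) (ys ! i)" "le (ys ! i) (zs ! i)"
        using A by (auto simp: multichains_def list_all2_conv_all_nth subset_iff)
      then show "le (xs ! i) (zs ! i)" using transp_onD[OF P(4)] by blast
    qed
  qed
  ultimately show ?thesis by (simp add: finite_poset_def poset_def)
qed

lemma bot_elem_least:
  assumes "finite_poset P le" "bounded_poset P le"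
  shows "bot_elem P le \<in> P" "x \<in> P \<Longrightarrow> le (bot_elem P le) x"
proof -
  have P: "finite P" "reflp_on P le" "antisymp_on P le" "transp_on P le"
    using assms by (auto simp: finite_poset_def poset_def)
  have uniq: "\<exists>!x. minimal_in P le x" using assms by (simp add: bounded_poset_def)
  have m: "minimal_in P le (bot_elem P le)"
    unfolding bot_elem_def by (rule theI'[OF uniq])
  then show "bot_elem P le \<in> P" by (simp add: minimal_in_def)
  assume x: "x \<in> P"
  let ?A = "{y \<in> P. le y x}"
  have as: "asymp_on ?A (strict le)"
    using P(3) by (auto simp: asymp_on_def antisymp_on_def strict_def)
  have tr: "transp_on ?A (strict le)"
  proof (rule transp_onI)
    fix a b c assume "a \<in> ?A" "b \<in> ?A" "c \<in> ?A" "strict le a b" "strict le b c"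
    then show "strict le a c"
      using transp_onD[OF P(4), of a b c] antisymp_onD[OF P(3), of a b]
      by (auto simp: strict_def)
  qed
  have "x \<in> ?A" using x reflp_onD[OF P(2)] by blast
  then obtain w where w: "w \<in> ?A" "\<forall>y\<in>?A. y \<noteq> w \<longrightarrow> \<not> strict le y w"
    using Finite_Set.bex_min_element[of ?A "strict le"] P(1) as tr by auto
  have "minimal_in P le w"
    unfolding minimal_in_def
  proof (intro conjI notI)
    show "w \<in> P" using w by simp
    assume "\<exists>y\<in>P. strict le y w"
    then obtain y where y: "y \<in> P" "strict le y w" by blast
    then have "le y x" using transp_onD[OF P(4), of y w x] w(1) x by (auto simp: strict_def)
    then show False using y w(2) by (auto simp: strict_def)
  qed
  then have "w = bot_elem P le" using uniq m by blast
  then show "le (bot_elem P le) x" using w by simp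
qed

lemma top_elem_greatest:
  assumes "finite_poset P le" "bounded_poset P le"
  shows "top_elem P le \<in> P" "x \<in> P \<Longrightarrow> le x (top_elem P le)"
proof -
  have eq: "strict (\<lambda>x y. le y x) a b \<longleftrightarrow> strict le b a" for a b
    by (auto simp: strict_def)
  have po: "poset P (\<lambda>x y. le y x)" if "poset P le"
    using that unfolding poset_def reflp_on_def antisymp_on_def transp_on_def by blast
  have mm: "minimal_in P (\<lambda>x y. le y x) = maximal_in P le"
    "maximal_in P (\<lambda>x y. le y x) = minimal_in P le"
    by (auto simp: fun_eq_iff minimal_in_def maximal_in_def eq)
  have bt: "bot_elem P (\<lambda>x y. le y x) = top_elem P le"
    by (simp add: bot_elem_def top_elem_def mm)
  have d: "finite_poset P (\<lambda>x y. le y x)" "bounded_poset P (\<lambda>x y. le y x)"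
    using assms po by (simp_all add: finite_poset_def bounded_poset_def mm)
  show "top_elem P le \<in> P" "x \<in> P \<Longrightarrow> le x (top_elem P le)"
    using bot_elem_least[OF d] by (simp_all add: bt)
qed

lemma replicate_in_multichains:
  assumes "finite_poset P le" "a \<in> P"
  shows "replicate m a \<in> multichains P le m"
proof -
  have "le a a" using assms by (auto simp: finite_poset_def poset_def dest: reflp_onD)
  then have "successively le (replicate m a)"
  proof (induction m)
    case (Suc m)
    then show ?case by (cases m) (simp_all add: successively_Cons)
  qed simp
  then show ?thesis using assms by (auto simp: multichains_def)
qed

text \<open>The constant tuples are the least and the greatest multichain.\<close>

lemma multichains_bounds:
  assumes "finite_poset P le" "bounded_poset P le"
  shows "replicate m (bot_elem P le) \<in> multichains P le m"
    and "replicate m (top_elem P le) \<in> multichains P le m"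
    and "xs \<in> multichains P le m \<Longrightarrow> componentwise le (replicate m (bot_elem P le)) xs"
    and "xs \<in> multichains P le m \<Longrightarrow> componentwise le xs (replicate m (top_elem P le))"
  using bot_elem_least[OF assms] top_elem_greatest[OF assms] replicate_in_multichains[OF assms(1)]
  by (auto simp: multichains_def list_all2_conv_all_nth subset_iff)

text \<open>
  For a one-element poset the Moebius number of the multichain poset is 1, not 0; this is why
  a statement on its vanishing has to exclude that \<open>bot_elem P le = top_elem P le\<close>.
\<close>

lemma mobius_multichains_trivial:
  assumes "finite_poset P le" "bounded_poset P le" "bot_elem P le = top_elem P le"
  shows "mobius (multichains P le m) (componentwise le)
           (replicate m (bot_elem P le)) (replicate m (top_elem P le)) = 1"
  using assms(3) mobius_refl[OF finite_poset_multichains multichains_bounds(2)] assms(1,2)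
  by metis

lemma EL_shellable_singleton: "EL_shellable TYPE('l) {a} (=)"
proof -
  have "\<not> covers {a} (=) x y" for x y
    by (auto simp: covers_def strict_def)
  then have s: "successively (covers {a} (=)) c \<longleftrightarrow> length c \<le> 1" for c
    by (cases c; cases "tl c") (auto simp: successively_Cons \<open>\<And>x y. \<not> covers {a} (=) x y\<close>)
  have mc: "maximal_chain {a} (=) a a c \<longleftrightarrow> c = [a]" for c
    unfolding maximal_chain_def s by (cases c) auto
  have "EL_labeling {a} (=) (UNIV :: 'l set) (=) f" for f
    using \<open>\<And>x y. \<not> covers {a} (=) x y\<close>
    by (auto simp: EL_labeling_def edge_labeling_def mc poset_def rising_def label_seq_def
        reflp_on_def antisymp_on_def transp_on_def)
  moreover have "bounded_poset {a} (=)"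
    by (auto simp: bounded_poset_def poset_def minimal_in_def maximal_in_def strict_def
        reflp_on_def antisymp_on_def transp_on_def)
  ultimately show ?thesis unfolding EL_shellable_def by blast
qed

end

theory Submission
  imports Defs
begin

text \<open>
  Replacing \<open>(x\<^sub>1, \<dots>, x\<^sub>m)\<close> by \<open>(x\<^sub>1, \<^bold>1, \<dots>, \<^bold>1)\<close> is a closure operator on the multichains
  that moves the least element (as \<open>m > 1\<close>) and sends no element other than the greatest one to
  the greatest one. By Rota's closure theorem the sum of \<open>\<mu>(\<^bold>0, x)\<close> over the elements \<open>x\<close> with a given
  closure is 0; over the greatest element this sum has a single term.
\<close>

lemma sum_mobius_interval_eq_0:
  assumes Q: "finite_poset Q le" and "x \<in> Q" "y \<in> Q" "strict le x y"
  shows "(\<Sum>z \<in> {z \<in> Q. le x z \<and> le z y}. mobius Q le x z) = 0"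
proof -
  have Q': "finite Q" "reflp_on Q le"
    using Q by (auto simp: finite_poset_def poset_def)
  have "{z \<in> Q. le x z \<and> le z y} = insert y {z \<in> Q. le x z \<and> strict le z y}"
    using assms Q' by (auto simp: strict_def dest: reflp_onD)
  moreover have "y \<notin> {z \<in> Q. le x z \<and> strict le z y}"
    by (simp add: strict_def)
  ultimately show ?thesis
    using Q' mobius_less[OF assms] by simp
qed

text \<open>Induction on the size of the down-set of \<open>a\<close>: the interval from
  \<open>z\<close> to \<open>a\<close> is the disjoint union of the fibres of \<open>j\<close> over
  the closed elements below \<open>a\<close>. The Moebius sum over the interval vanishes, and so do
  the fibre sums over closed \<open>b\<close> strictly below \<open>a\<close>, which leaves the
  fibre of \<open>a\<close>.\<close>

lemma sum_mobius_closure_fibre_eq_0: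
  assumes Q: "finite_poset Q le"
    and z: "z \<in> Q" "\<And>x. x \<in> Q \<Longrightarrow> le z x"
    and j: "\<And>x. x \<in> Q \<Longrightarrow> j x \<in> Q" "\<And>x. x \<in> Q \<Longrightarrow> le x (j x)"
      "\<And>x y. x \<in> Q \<Longrightarrow> y \<in> Q \<Longrightarrow> le x y \<Longrightarrow> le (j x) (j y)"
      "\<And>x. x \<in> Q \<Longrightarrow> j (j x) = j x"
    and jz: "j z \<noteq> z"
    and a: "a \<in> Q" "j a = a"
  shows "(\<Sum>x \<in> {x \<in> Q. j x = a}. mobius Q le z x) = 0"
  using a
proof (induction "card {x \<in> Q. le x a}" arbitrary: a rule: less_induct)
  case less
  have Q': "finite Q" "reflp_on Q le" "antisymp_on Q le" "transp_on Q le"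
    using Q by (auto simp: finite_poset_def poset_def)
  define B where "B = {b \<in> Q. j b = b \<and> le b a}"
  let ?S = "\<lambda>b. \<Sum>x \<in> {x \<in> Q. j x = b}. mobius Q le z x"
  \<comment> \<open>\<open>a\<close> is closed and \<open>z\<close> is not, so the interval is never
    trivial; hence the induction needs no separate base case.\<close>
  have za: "strict le z a"
    using z less.prems jz by (auto simp: strict_def)
  have aB: "a \<in> B" "finite B"
    using less.prems Q' by (auto simp: B_def dest: reflp_onD)
  have below: "?S b = 0" if b: "b \<in> B - {a}" for b
  proof -
    have bQ: "b \<in> Q" "j b = b" "le b a" "b \<noteq> a" using b by (auto simp: B_def)
    have "{x \<in> Q. le x b} \<subseteq> {x \<in> Q. le x a}"
      using transp_onD[OF Q'(4)] bQ less.prems by blast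
    moreover have "a \<in> {x \<in> Q. le x a}" "a \<notin> {x \<in> Q. le x b}"
      using less.prems bQ reflp_onD[OF Q'(2)] antisymp_onD[OF Q'(3)] by blast+
    ultimately have "{x \<in> Q. le x b} \<subset> {x \<in> Q. le x a}" by blast
    then show ?thesis
      using less.hyps[of b] bQ Q'(1) by (simp add: psubset_card_mono)
  qed
  \<comment> \<open>Since \<open>a\<close> is closed, monotonicity gives one direction and
    \<open>le x (j x)\<close> the other. Thus the interval below \<open>a\<close> contains each
    fibre it meets as a whole.\<close>
  have le_iff: "le x a \<longleftrightarrow> le (j x) a" if x: "x \<in> Q" for x
    using j(3)[OF x less.prems(1)] less.prems(2) transp_onD[OF Q'(4) x j(1)[OF x] less.prems(1)]
      j(2)[OF x] by auto
  have "le z x \<and> le x a \<longleftrightarrow> j x \<in> B" if "x \<in> Q" for x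
    unfolding le_iff[OF that] B_def using z(2)[OF that] j(1)[OF that] j(4)[OF that] by blast
  then have int: "{x \<in> Q. le z x \<and> le x a} = {x \<in> Q. j x \<in> B}"
    by blast
  have "0 = (\<Sum>x \<in> {x \<in> Q. j x \<in> B}. mobius Q le z x)"
    using sum_mobius_interval_eq_0[OF Q z(1) less.prems(1) za] int by simp
  also have "\<dots> = (\<Sum>b \<in> B. \<Sum>x \<in> {x \<in> {x \<in> Q. j x \<in> B}. j x = b}. mobius Q le z x)"
    by (rule sum.group[symmetric]) (use Q' aB in auto)
  also have "\<dots> = (\<Sum>b \<in> B. ?S b)"
    by (intro sum.cong refl) auto
  also have "\<dots> = ?S a + (\<Sum>b \<in> B - {a}. ?S b)"
    using aB by (intro sum.remove)
  also have "\<dots> = ?S a"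
    using below by simp
  finally show ?case by simp
qed

text \<open>With \<open>a\<close> the head of a multichain, this makes the closure operator map
  multichains to multichains.\<close>

lemma hd_top_in_multichains:
  assumes "finite_poset P le" "bounded_poset P le" "a \<in> P"
  shows "a # replicate k (top_elem P le) \<in> multichains P le (Suc k)"
  using replicate_in_multichains[OF assms(1) top_elem_greatest(1)[OF assms(1,2)], of k]
    top_elem_greatest[OF assms(1,2)] assms(3)
  by (cases k) (auto simp: multichains_def)

text \<open>The head is the least entry of a multichain, so a head equal to the top forces all
  entries to be the top. Hence the fibre over the greatest multichain is a singleton.\<close>

lemma hd_top_eq_top_iff:
  assumes "finite_poset P le" "bounded_poset P le" "xs \<in> multichains P le (Suc k)"
  shows "hd xs # replicate k (top_elem P le) = replicate (Suc k) (top_elem P le)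
    \<longleftrightarrow> xs = replicate (Suc k) (top_elem P le)"
proof
  let ?t = "top_elem P le"
  have P: "antisymp_on P le" "transp_on P le"
    using assms by (auto simp: finite_poset_def poset_def)
  assume "hd xs # replicate k ?t = replicate (Suc k) ?t"
  then obtain ys where xs: "xs = ?t # ys" "length ys = k" "set ys \<subseteq> P"
      "successively le (?t # ys)"
    using assms(3) by (cases xs) (auto simp: multichains_def)
  have "y = ?t" if "y \<in> set ys" for y
  proof -
    have tr: "transp_on (set (?t # ys)) le"
      using P(2) xs(3) top_elem_greatest(1)[OF assms(1,2)] by (auto intro: transp_on_subset)
    \<comment> \<open>Transitivity turns the comparison of neighbours into one of the head with
      every later entry.\<close>
    have "sorted_wrt le (?t # ys)"
      using xs(4) tr by (subst (asm) successively_iff_sorted_wrt_strong) (auto dest: transp_onD)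
    then have "le ?t y" using that by simp
    then show ?thesis
      using that xs(3) top_elem_greatest[OF assms(1,2)] antisymp_onD[OF P(1)] by blast
  qed
  then show "xs = replicate (Suc k) ?t"
    using xs by (simp add: replicate_eqI)
qed simp

theorem proposition3p5:
  fixes P :: "'a set" and le :: "'a \<Rightarrow> 'a \<Rightarrow> bool" and m :: nat
  assumes "finite_poset P le"
    and "EL_shellable TYPE('l) P le"
    and "bot_elem P le \<noteq> top_elem P le"
    and "m > 1"
  shows "mobius (multichains P le m) (componentwise le)
           (replicate m (bot_elem P le)) (replicate m (top_elem P le)) = 0"
proof -
  let ?t = "top_elem P le" and ?b = "bot_elem P le"
  obtain k where m: "m = Suc k" "k \<noteq> 0"
    using assms(4) by (cases m) auto
  have bd: "bounded_poset P le"
    using assms(2) by (simp add: EL_shellable_def)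
  note fb = assms(1) bd
  let ?Q = "multichains P le m" and ?j = "\<lambda>xs. hd xs # replicate k ?t"
  have Cons: "\<exists>x ys. xs = x # ys \<and> x \<in> P \<and> set ys \<subseteq> P \<and> length ys = k" if "xs \<in> ?Q" for xs
    using that m by (cases xs) (auto simp: multichains_def)
  have tt: "le ?t ?t"
    using top_elem_greatest[OF fb] by blast
  have "(\<Sum>x \<in> {x \<in> ?Q. ?j x = replicate m ?t}.
      mobius ?Q (componentwise le) (replicate m ?b) x) = 0"
  proof (rule sum_mobius_closure_fibre_eq_0)
    show "finite_poset ?Q (componentwise le)"
      by (rule finite_poset_multichains[OF assms(1)])
    show "replicate m ?b \<in> ?Q" "replicate m ?t \<in> ?Q"
      by (rule multichains_bounds[OF fb])+
    show "componentwise le (replicate m ?b) xs" if "xs \<in> ?Q" for xs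
      using multichains_bounds(3)[OF fb that] .
    show "?j xs \<in> ?Q" if "xs \<in> ?Q" for xs
      using Cons[OF that] hd_top_in_multichains[OF fb] m by auto
    show "componentwise le xs (?j xs)" if "xs \<in> ?Q" for xs
      using Cons[OF that] top_elem_greatest[OF fb] assms(1)
      by (auto simp: list_all2_conv_all_nth nth_Cons' subset_iff finite_poset_def poset_def
          dest: reflp_onD)
    show "componentwise le (?j xs) (?j ys)"
      if "xs \<in> ?Q" "ys \<in> ?Q" "componentwise le xs ys" for xs ys
      using Cons[OF that(1)] Cons[OF that(2)] that(3) tt
      by (auto simp: list_all2_conv_all_nth nth_Cons')
    \<comment> \<open>As \<open>k\<close> is nonzero, there is a second entry, and it changes from
      \<open>?b\<close> to the different element \<open>?t\<close>.\<close>
    show "?j (replicate m ?b) \<noteq> replicate m ?b"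
      using m assms(3) by (cases k) auto
  \<comment> \<open>What remains is that \<open>?j\<close> is idempotent and fixes the greatest
    multichain.\<close>
  qed (use m in simp_all)
  \<comment> \<open>The fibre sum thus reduces to the single Moebius value in question.\<close>
  moreover have "{x \<in> ?Q. ?j x = replicate m ?t} = {replicate m ?t}"
    using hd_top_eq_top_iff[OF fb] multichains_bounds(2)[OF fb, of m] unfolding m(1) by blast
  ultimately show ?thesis by simp
qed

end
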